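(* Let $p\ge3$ be a prime. A minimal polynomial expression of $\max(x_0,x_1)$ on $\mathbb{F}_p{}^2$ is \[ \max(x_0,x_1)=(x_1-x_0)\sum_{d=2}^{p-2}d^{-1}(x_0+1)(x_0+2)\cdots(x_0+d)\;x_1(x_1-1)\cdots(x_1-(p-d)+1) +x_0+(x_0+1)^2\bigl(1-(x_1+1)^{p-1}\bigr)+\bigl(1-x_0^{p-1}\bigr)x_1^2, \] where $d^{-1}$ is the inverse of $d$ in $\mathbb{F}_p$ (and the sum is empty when $p=3$).
   Context: $\mathbb{F}_p$ is identified with $\{0,1,\dots,p-1\}$ with the usual ordering, and $\max(x_0,x_1)$ is the larger of $x_0,x_1$ in this ordering. A minimal polynomial expression is a polynomial over $\mathbb{F}_p$ of degree at most $p-1$ in each variable coinciding with the function on all of $\mathbb{F}_p{}^2$. *)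

theory Defs
  imports
    "HOL-Computational_Algebra.Polynomial"
    "Berlekamp_Zassenhaus.Finite_Field"
begin

text \<open>
  The field with p elements is the type \<open>'p mod_ring\<close>, where \<open>'p\<close> is a type of prime
  cardinality p; its elements are represented by the integers 0, ..., p - 1.
  That type carries no order, so \<open>max\<close> is taken with respect to these representatives.
\<close>

definition max_mod_ring :: "'p::finite mod_ring \<Rightarrow> 'p mod_ring \<Rightarrow> 'p mod_ring" where
  "max_mod_ring a b = (if to_int_mod_ring a \<le> to_int_mod_ring b then b else a)"

text \<open>
  A polynomial in \<open>x\<^sub>0\<close>, \<open>x\<^sub>1\<close> is an element of \<open>'a poly poly\<close>, that is, a polynomial in \<open>x\<^sub>1\<close>
  whose coefficients are polynomials in \<open>x\<^sub>0\<close>.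
\<close>

definition X0 :: "'a::comm_ring_1 poly poly" where
  "X0 = [:[:0, 1:]:]"

definition X1 :: "'a::comm_ring_1 poly poly" where
  "X1 = [:0, 1:]"

definition const2 :: "'a::comm_ring_1 \<Rightarrow> 'a poly poly" where
  "const2 c = [:[:c:]:]"

definition eval2 :: "'a::comm_ring_1 poly poly \<Rightarrow> 'a \<Rightarrow> 'a \<Rightarrow> 'a" where
  "eval2 P a b = poly (poly P [:b:]) a"

definition degree_X0 :: "'a::comm_ring_1 poly poly \<Rightarrow> nat" where
  "degree_X0 P = Max (range (\<lambda>j. degree (coeff P j)))"
  \<comment> \<open>The range is finite, as almost all coefficients are 0.\<close>

definition degree_X1 :: "'a::comm_ring_1 poly poly \<Rightarrow> nat" where
  "degree_X1 P = degree P"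

definition minimal_polynomial_expression ::
  "'p::prime_card mod_ring poly poly \<Rightarrow> ('p mod_ring \<Rightarrow> 'p mod_ring \<Rightarrow> 'p mod_ring) \<Rightarrow> bool" where
  "minimal_polynomial_expression P f \<longleftrightarrow>
     degree_X0 P \<le> CARD('p) - 1 \<and> degree_X1 P \<le> CARD('p) - 1 \<and>
     (\<forall>a b. eval2 P a b = f a b)"

end

theory Submission
  imports Defs
begin

text \<open>
  For \<open>0 \<le> a, b < p\<close> let \<open>S(a, b)\<close> be the sum of the formula extended to \<open>1 \<le> d \<le> p - 1\<close>.
  Then \<open>S(a, 0) = 0\<close>, and since \<open>p - d = - d\<close> in the field the factor \<open>1 / d\<close> cancels in
  \<open>S(a, b + 1) - S(a, b) = - (\<Sum>d. (a + 1)\<cdots>(a + d) b(b - 1)\<cdots>(b - (p - 1 - d) + 1))\<close>.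
  Multiplied by \<open>a - b\<close> the sum on the right telescopes to 0, and for \<open>a = b\<close> only
  \<open>d = p - 1 - a\<close> survives, with value \<open>(p - 1)! = - 1\<close>. Hence \<open>S(a, b)\<close> is 1 if \<open>a < b\<close> and
  0 otherwise, so \<open>max(a, b) = a + (b - a) S(a, b)\<close>. The terms \<open>d = 1\<close> and \<open>d = p - 1\<close> would have
  degree p in one variable; as functions they agree with the two correction terms.
\<close>

section \<open>Rising and falling factorials in a commutative ring\<close>

abbreviation (input) rising :: "'a::comm_ring_1 \<Rightarrow> nat \<Rightarrow> 'a" where
  "rising a d \<equiv> \<Prod>i = 1..d. a + of_nat i"

abbreviation (input) falling :: "'a::comm_ring_1 \<Rightarrow> nat \<Rightarrow> 'a" where
  "falling b k \<equiv> \<Prod>i = 0..<k. b - of_nat i"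

lemma rising_Suc: "rising a (Suc d) = rising a d * (a + of_nat (Suc d))"
  by simp

lemma falling_Suc: "falling b (Suc k) = falling b k * (b - of_nat k)"
  by simp

lemma falling_add_one_Suc: "falling (b + 1) (Suc k) = (b + 1) * falling b k"
proof -
  have "falling (b + 1) (Suc k) = (b + 1) * (\<Prod>i = 0..<k. b + 1 - of_nat (Suc i))"
    by (subst prod.atLeast0_lessThan_Suc_shift) simp
  then show ?thesis by (simp add: algebra_simps)
qed

text \<open>The discrete analogue of differentiating a power: both products share the factor
  \<open>falling b k\<close>, and the remaining factors \<open>b + 1\<close> and
  \<open>b - k\<close> differ by \<open>k + 1\<close>.\<close>

lemma falling_add_one_diff:
  "falling (b + 1) (Suc k) - falling b (Suc k) = of_nat (Suc k) * falling b k"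
  unfolding falling_add_one_Suc falling_Suc by (simp add: algebra_simps)

lemma falling_of_nat_eq_0: "m < k \<Longrightarrow> falling (of_nat m) k = 0"
  by (subst prod_zero) auto

lemma falling_of_nat_self: "falling (of_nat n) n = of_nat (fact n)"
proof (induction n)
  case (Suc n)
  have "falling (of_nat (Suc n)) (Suc n) = (of_nat n + 1) * falling (of_nat n :: 'a) n"
    using falling_add_one_Suc[of "of_nat n" n] by (simp add: add.commute)
  with Suc show ?case by (simp add: algebra_simps)
qed simp

text \<open>The quotient \<open>(n + d)! / n!\<close>, written without division so that it makes
  sense in any commutative ring.\<close>

lemma fact_mult_rising: "of_nat (fact n) * rising (of_nat n) d = of_nat (fact (n + d))"
proof (induction d)
  case (Suc d)
  have "of_nat (fact n) * rising (of_nat n) (Suc d) =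
      of_nat (fact n) * rising (of_nat n) d * (of_nat (n + Suc d) :: 'a)"
    unfolding rising_Suc by (simp only: mult.assoc of_nat_add)
  also have "\<dots> = of_nat (Suc (n + d)) * of_nat (fact (n + d))"
    unfolding Suc by (simp add: mult.commute)
  finally show ?case
    by (simp only: fact_Suc add_Suc_right of_nat_mult of_nat_id)
qed simp

lemma mult_sum_rising_falling:
  fixes a b :: "'a::comm_ring_1"
  assumes "(of_nat p :: 'a) = 0"
  shows "(a - b) * (\<Sum>d<p. rising a d * falling b (p - 1 - d)) = rising a p - falling b p"
proof -
  define G where "G d = rising a d * falling b (p - d)" for d
  have "(a - b) * (rising a d * falling b (p - 1 - d)) = G (Suc d) - G d" if "d < p" for d
  proof -
    \<comment> \<open>Since \<open>p = 0\<close> in the ring, the last factor of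
      \<open>falling b (p - d)\<close> is \<open>b + (d + 1)\<close>. The new factor of
      \<open>rising a (Suc d)\<close> is \<open>a + (d + 1)\<close>, so the two differ by exactly
      \<open>a - b\<close>.\<close>
    have "(of_nat (p - 1 - d) :: 'a) = of_nat p - of_nat (Suc d)"
      using that by (subst of_nat_diff[symmetric]) simp_all
    then have c: "b - of_nat (p - 1 - d) = b + of_nat (Suc d)"
      using assms by simp
    have "p - d = Suc (p - 1 - d)" using that by simp
    then have "falling b (p - d) = falling b (p - 1 - d) * (b + of_nat (Suc d))"
      by (simp only: falling_Suc c)
    then show ?thesis
      unfolding G_def rising_Suc by (simp add: algebra_simps)
  qed
  then have "(a - b) * (\<Sum>d<p. rising a d * falling b (p - 1 - d)) = (\<Sum>d<p. G (Suc d) - G d)"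
    by (simp add: sum_distrib_left)
  also have "\<dots> = G p - G 0" by (rule sum_lessThan_telescope)
  finally show ?thesis by (simp add: G_def)
qed

section \<open>Factorials and vanishing products in the prime field\<close>

lemma wilson_mod_ring: "of_nat (fact (CARD('a) - 1)) = (-1 :: 'a::prime_card mod_ring)"
proof -
  have "(of_int (int (fact (CARD('a) - 1))) :: 'a mod_ring) = of_int (-1)"
    unfolding of_int_eq_iff_cong_CHAR using wilson_theorem[OF prime_card[where 'a = 'a]] by simp
  then show ?thesis by (simp only: of_int_of_nat_eq of_int_minus of_int_1)
qed

lemma of_nat_CARD_minus_1: "of_nat (CARD('a) - 1) = (-1 :: 'a::prime_card mod_ring)"
  using nontriv[where 'a = 'a] by (subst of_nat_diff) auto

lemma of_nat_mod_ring_eq_iff: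
  assumes "n < CARD('a)" and "m < CARD('a)"
  shows "(of_nat n :: 'a::prime_card mod_ring) = of_nat m \<longleftrightarrow> n = m"
  using assms by (auto simp: of_nat_eq_iff_cong_CHAR cong_def)

text \<open>The factor with index \<open>p - n\<close> is \<open>p = 0\<close>; the two assumptions
  place this index in \<open>{1..d}\<close>.\<close>

lemma rising_of_nat_eq_0:
  assumes "n < CARD('a)" and "CARD('a) \<le> n + d"
  shows "rising (of_nat n :: 'a::prime_card mod_ring) d = 0"
proof (rule prod_zero)
  have "of_nat n + of_nat (CARD('a) - n) = (of_nat CARD('a) :: 'a mod_ring)"
    using assms by (subst of_nat_add[symmetric]) simp
  then show "\<exists>i\<in>{1..d}. of_nat n + of_nat i = (0 :: 'a mod_ring)"
    using assms by (intro bexI[of _ "CARD('a) - n"]) auto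
qed simp

section \<open>The indicator of \<open>n < m\<close> as a sum of products\<close>

lemma sum_rising_falling_mod_ring:
  fixes a b :: "'a::prime_card mod_ring"
  shows "(\<Sum>d<CARD('a). rising a d * falling b (CARD('a) - 1 - d)) = (if a = b then -1 else 0)"
proof -
  let ?p = "CARD('a)"
  obtain n where n: "n < ?p" "a = of_nat n" using surj_of_nat_mod_ring[of a] by auto
  obtain m where m: "m < ?p" "b = of_nat m" using surj_of_nat_mod_ring[of b] by auto
  show ?thesis
  proof (cases "a = b")
    case False
    have "(a - b) * (\<Sum>d<?p. rising a d * falling b (?p - 1 - d)) = rising a ?p - falling b ?p"
      by (rule mult_sum_rising_falling) simp
    \<comment> \<open>A product of p consecutive factors meets zero: the rising one at index
      \<open>p - n\<close>, the falling one at index \<open>m\<close>.\<close>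
    also have "\<dots> = 0"
      unfolding n(2) m(2) rising_of_nat_eq_0[OF n(1) le_add2] falling_of_nat_eq_0[OF m(1)] by simp
    finally show ?thesis using False by simp
  next
    case True
    have "(\<Sum>d<?p. rising a d * falling b (?p - 1 - d)) =
        (\<Sum>d\<in>{?p - 1 - n}. rising a d * falling b (?p - 1 - d))"
    proof (rule sum.mono_neutral_right)
      show "\<forall>d\<in>{..<?p} - {?p - 1 - n}. rising a d * falling b (?p - 1 - d) = 0"
      proof
        fix d assume d: "d \<in> {..<?p} - {?p - 1 - n}"
        \<comment> \<open>An index above \<open>p - 1 - n\<close> makes the rising product vanish,
          an index below it the falling one.\<close>
        then consider "?p \<le> n + d" | "n < ?p - 1 - d" by fastforce
        then show "rising a d * falling b (?p - 1 - d) = 0"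
        proof cases
          case 1
          then show ?thesis using rising_of_nat_eq_0[OF n(1)] n by simp
        next
          case 2
          then show ?thesis
            unfolding True[symmetric] n(2) by (simp only: falling_of_nat_eq_0 mult_zero_right)
        qed
      qed
    qed (use n in auto)
    also have "\<dots> = rising a (?p - 1 - n) * falling (of_nat n) n"
      using n True by auto
    \<comment> \<open>The falling product is \<open>n!\<close> and the rising one continues it with
      the factors from \<open>n + 1\<close> to \<open>p - 1\<close>.\<close>
    also have "\<dots> = of_nat (fact (?p - 1))"
      using n fact_mult_rising[of n "?p - 1 - n", where 'a = "'a mod_ring"]
      unfolding falling_of_nat_self by (simp add: mult.commute)
    finally show ?thesis using True wilson_mod_ring[where 'a = 'a] by simp
  qed
qed

text \<open>By induction on \<open>m\<close>: the sum starts at 0, and passing from \<open>m\<close>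
  to \<open>m + 1\<close> changes it only if \<open>m = n\<close>, where it grows by 1.\<close>

lemma sum_inverse_rising_falling:
  assumes "n < CARD('a)" and "m < CARD('a)"
  shows "(\<Sum>d = 1..<CARD('a). inverse (of_nat d) *
      rising (of_nat n :: 'a::prime_card mod_ring) d * falling (of_nat m) (CARD('a) - d)) =
    (if n < m then 1 else 0)"
  using assms(2)
proof (induction m)
  case 0
  have "falling (of_nat 0 :: 'a mod_ring) (CARD('a) - d) = 0" if "d < CARD('a)" for d
    using that by (intro falling_of_nat_eq_0) simp
  then have "(\<Sum>d = 1..<CARD('a). inverse (of_nat d) * rising (of_nat n :: 'a mod_ring) d *
      falling (of_nat 0) (CARD('a) - d)) = 0"
    by (intro sum.neutral ballI) (simp only: atLeastLessThan_iff mult_zero_right)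
  then show ?case by (simp only: not_less_zero if_False)
next
  case (Suc m)
  let ?p = "CARD('a)" and ?a = "of_nat n :: 'a mod_ring" and ?b = "of_nat m :: 'a mod_ring"
  let ?S = "\<lambda>b. \<Sum>d = 1..<?p. inverse (of_nat d) * rising ?a d * falling b (?p - d)"
  have "inverse (of_nat d) * rising ?a d * falling (?b + 1) (?p - d) -
      inverse (of_nat d) * rising ?a d * falling ?b (?p - d) =
      - (rising ?a d * falling ?b (?p - 1 - d))" if d: "d \<in> {1..<?p}" for d
  proof -
    have k: "?p - d = Suc (?p - 1 - d)" using d by auto
    \<comment> \<open>The difference rule for falling factorials yields the coefficient
      \<open>p - d\<close>, which is \<open>- d\<close> in the field and so cancels the inverse up
      to sign.\<close>
    have "of_nat (Suc (?p - 1 - d)) = (- of_nat d :: 'a mod_ring)"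
      unfolding k[symmetric] using d by (simp add: of_nat_diff)
    then have diff: "falling (?b + 1) (?p - d) - falling ?b (?p - d) =
        - of_nat d * falling ?b (?p - 1 - d)"
      unfolding k by (simp only: falling_add_one_diff)
    have nz: "(of_nat d :: 'a mod_ring) \<noteq> 0"
      using of_nat_mod_ring_eq_iff[of d 0, where 'a = 'a] d by auto
    have "inverse (of_nat d) * rising ?a d * falling (?b + 1) (?p - d) -
        inverse (of_nat d) * rising ?a d * falling ?b (?p - d) =
        inverse (of_nat d) * rising ?a d * (falling (?b + 1) (?p - d) - falling ?b (?p - d))"
      by (rule right_diff_distrib[symmetric])
    also have "\<dots> = - (inverse (of_nat d) * of_nat d) * (rising ?a d * falling ?b (?p - 1 - d))"
      unfolding diff by (simp only: mult_ac minus_mult_left[symmetric] minus_mult_right[symmetric])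
    finally show ?thesis using nz by simp
  qed
  then have "?S (?b + 1) - ?S ?b = - (\<Sum>d = 1..<?p. rising ?a d * falling ?b (?p - 1 - d))"
    unfolding sum_subtractf[symmetric] sum_negf[symmetric] by (intro sum.cong) auto
  \<comment> \<open>The term \<open>d = 0\<close> can be added because its falling product of length
    \<open>p - 1\<close> vanishes: \<open>Suc m < p\<close> puts the factor \<open>m - m\<close>
    into it.\<close>
  also have "(\<Sum>d = 1..<?p. rising ?a d * falling ?b (?p - 1 - d)) =
      (\<Sum>d<?p. rising ?a d * falling ?b (?p - 1 - d))"
  proof (rule sum.mono_neutral_left)
    have "falling ?b (?p - 1) = 0"
      using Suc.prems by (intro falling_of_nat_eq_0) simp
    moreover have "{..<?p} - {1..<?p} = {0}"
      using Suc.prems by auto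
    ultimately show "\<forall>d\<in>{..<?p} - {1..<?p}. rising ?a d * falling ?b (?p - 1 - d) = 0"
      by simp
  qed auto
  also have "\<dots> = (if n = m then -1 else 0)"
    using assms(1) Suc.prems
    by (simp only: sum_rising_falling_mod_ring of_nat_mod_ring_eq_iff Suc_lessD)
  finally have "?S (?b + 1) = ?S ?b + (if n = m then 1 else 0)"
    by (simp add: algebra_simps split: if_splits)
  also have "?S ?b = (if n < m then 1 else 0)"
    using Suc by simp
  finally show ?case by (simp add: add.commute[of 1] split: if_splits)
qed

section \<open>Products of length p - 1 as powers\<close>

lemma power_CARD_minus_1:
  "a ^ (CARD('a) - 1) = (if a = 0 then 0 else 1 :: 'a::prime_card mod_ring)"
proof -
  have "a ^ (CARD('a) - 1) * a = a"
    using finite_field_power_card_eq_same[of a] nontriv[where 'a = 'a]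
    by (simp flip: power_Suc2)
  then show ?thesis using nontriv[where 'a = 'a] by auto
qed

text \<open>The shifts run through all nonzero elements, so some factor is 0 unless
  \<open>a = 0\<close>, where the product is \<open>(p - 1)! = - 1\<close>. Fermat's theorem gives
  the right-hand side the same values.\<close>

lemma rising_CARD_minus_1:
  fixes a :: "'a::prime_card mod_ring"
  shows "rising a (CARD('a) - 1) = a ^ (CARD('a) - 1) - 1"
proof -
  obtain n where n: "n < CARD('a)" "a = of_nat n" using surj_of_nat_mod_ring[of a] by auto
  show ?thesis
  proof (cases "n = 0")
    case True
    then have a: "a = of_nat 0" using n by simp
    have "rising a (CARD('a) - 1) = -1"
      using fact_mult_rising[of 0 "CARD('a) - 1", where 'a = "'a mod_ring"]
      unfolding a add_0 wilson_mod_ring by simp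
    then show ?thesis by (simp only: a power_CARD_minus_1) simp
  next
    case False
    then have "a \<noteq> 0" using n of_nat_mod_ring_eq_iff[of n 0, where 'a = 'a] by simp
    moreover have "rising a (CARD('a) - 1) = 0"
      unfolding n(2) using n(1) False by (intro rising_of_nat_eq_0) simp_all
    ultimately show ?thesis unfolding power_CARD_minus_1 by simp
  qed
qed

text \<open>The only element not subtracted is \<open>p - 1 = - 1\<close>. There the product is
  \<open>(p - 1)! = - 1\<close>, and elsewhere both sides are 0.\<close>

lemma falling_CARD_minus_1:
  fixes b :: "'a::prime_card mod_ring"
  shows "falling b (CARD('a) - 1) = (b + 1) ^ (CARD('a) - 1) - 1"
proof -
  obtain m where m: "m < CARD('a)" "b = of_nat m" using surj_of_nat_mod_ring[of b] by auto
  have iff: "b + 1 = 0 \<longleftrightarrow> m = CARD('a) - 1"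
    using m of_nat_mod_ring_eq_iff[of m "CARD('a) - 1", where 'a = 'a]
    by (simp add: of_nat_CARD_minus_1 eq_neg_iff_add_eq_0)
  show ?thesis
  proof (cases "m = CARD('a) - 1")
    case True
    then show ?thesis
      using m iff unfolding power_CARD_minus_1
      by (simp only: falling_of_nat_self wilson_mod_ring simp_thms if_True diff_0)
  next
    case False
    then have "falling b (CARD('a) - 1) = 0"
      unfolding m(2) using m(1) by (intro falling_of_nat_eq_0) simp
    then show ?thesis unfolding power_CARD_minus_1 using False iff by simp
  qed
qed

section \<open>The formula as an identity of functions\<close>

lemma max_mod_ring_of_nat:
  assumes "n < CARD('a)" and "m < CARD('a)"
  shows "max_mod_ring (of_nat n) (of_nat m :: 'a::prime_card mod_ring) =
    (if n \<le> m then of_nat m else of_nat n)"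
  using assms by (simp add: max_mod_ring_def of_nat_of_int_mod_ring)

lemma max_mod_ring_eq:
  fixes a b :: "'a::prime_card mod_ring"
  assumes "CARD('a) \<ge> 3"
  shows "max_mod_ring a b =
    (b - a) * (\<Sum>d = 2..CARD('a) - 2. inverse (of_nat d) * rising a d * falling b (CARD('a) - d))
    + a + (a + 1)\<^sup>2 * (1 - (b + 1) ^ (CARD('a) - 1)) + (1 - a ^ (CARD('a) - 1)) * b\<^sup>2"
proof -
  let ?p = "CARD('a)"
  obtain n where n: "n < ?p" "a = of_nat n" using surj_of_nat_mod_ring[of a] by auto
  obtain m where m: "m < ?p" "b = of_nat m" using surj_of_nat_mod_ring[of b] by auto
  let ?t = "\<lambda>d. inverse (of_nat d) * rising a d * falling b (?p - d)"
  \<comment> \<open>For \<open>p = 3\<close> the inner range is empty, but 1 and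
    \<open>p - 1\<close> are still distinct.\<close>
  have "{1..<?p} = insert 1 (insert (?p - 1) {2..?p - 2})"
    using assms by auto
  then have S: "(\<Sum>d = 1..<?p. ?t d) = ?t 1 + ?t (?p - 1) + (\<Sum>d = 2..?p - 2. ?t d)"
  proof -
    have "1 \<notin> insert (?p - 1) {2..?p - 2}" "?p - 1 \<notin> {2..?p - 2}"
      using assms by auto
    then show ?thesis
      unfolding \<open>{1..<?p} = _\<close>
      by (simp only: sum.insert finite_insert finite_atLeastAtMost add.assoc not_False_eq_True)
  qed
  have "(b - a) * ?t 1 = (b - a) * (a + 1) * ((b + 1) ^ (?p - 1) - 1)"
    using falling_CARD_minus_1[of b] by simp
  \<comment> \<open>Both sides vanish unless \<open>b = - 1\<close>, and there
    \<open>b - a = - (a + 1)\<close>.\<close>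
  also have "\<dots> = (a + 1)\<^sup>2 * (1 - (b + 1) ^ (?p - 1))"
  proof (cases "b + 1 = 0")
    case True
    then have "b = -1" by (simp add: eq_neg_iff_add_eq_0)
    then show ?thesis by (simp add: power_CARD_minus_1 power2_eq_square algebra_simps)
  next
    case False
    then show ?thesis unfolding power_CARD_minus_1 by simp
  qed
  finally have t1: "(b - a) * ?t 1 = (a + 1)\<^sup>2 * (1 - (b + 1) ^ (?p - 1))" .
  have "?p - (?p - 1) = 1" using assms by simp
  \<comment> \<open>The coefficient is the inverse of \<open>- 1\<close>, which flips the sign of
    \<open>a ^ (p - 1) - 1\<close>; the falling product has length 1.\<close>
  then have "(b - a) * ?t (?p - 1) = (b - a) * ((1 - a ^ (?p - 1)) * b)"
    unfolding rising_CARD_minus_1 of_nat_CARD_minus_1 by simp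
  \<comment> \<open>The first factor on the right is supported at \<open>a = 0\<close>, where
    \<open>b - a = b\<close>.\<close>
  also have "\<dots> = (1 - a ^ (?p - 1)) * b\<^sup>2"
    unfolding power_CARD_minus_1 by (simp add: power2_eq_square)
  finally have t2: "(b - a) * ?t (?p - 1) = (1 - a ^ (?p - 1)) * b\<^sup>2" .
  have "max_mod_ring a b = a + (b - a) * (if n < m then 1 else 0)"
    using n m by (auto simp: max_mod_ring_of_nat)
  also have "(if n < m then 1 else 0) = (\<Sum>d = 1..<?p. ?t d)"
    unfolding n(2) m(2) by (rule sum_inverse_rising_falling[OF n(1) m(1), symmetric])
  also have "a + (b - a) * (\<Sum>d = 1..<?p. ?t d) =
      (b - a) * (\<Sum>d = 2..?p - 2. ?t d) + a + (b - a) * ?t 1 + (b - a) * ?t (?p - 1)"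
    unfolding S distrib_left by (simp only: add_ac)
  finally show ?thesis unfolding t1 t2 .
qed

section \<open>Degree in the inner variable \<open>X0\<close>\<close>

lemma degree_X0_le_iff: "degree_X0 P \<le> n \<longleftrightarrow> (\<forall>j. degree (coeff P j) \<le> n)"
proof -
  \<comment> \<open>Coefficients beyond the degree of \<open>P\<close> are 0 and have degree 0,
    which the inserted 0 covers. Hence the \<open>Max\<close> is over a finite set.\<close>
  have "range (\<lambda>j. degree (coeff P j)) \<subseteq> insert 0 ((\<lambda>j. degree (coeff P j)) ` {..degree P})"
  proof (rule image_subsetI)
    fix j
    show "degree (coeff P j) \<in> insert 0 ((\<lambda>j. degree (coeff P j)) ` {..degree P})"
      by (cases "j \<le> degree P") (simp_all add: coeff_eq_0)
  qed
  then have "finite (range (\<lambda>j. degree (coeff P j)))"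
    by (rule finite_subset) simp
  then show ?thesis by (simp add: degree_X0_def)
qed

lemma degree_X0_add_le:
  "degree_X0 P \<le> n \<Longrightarrow> degree_X0 Q \<le> n \<Longrightarrow> degree_X0 (P + Q) \<le> n"
  by (simp add: degree_X0_le_iff degree_add_le)

lemma degree_X0_diff_le:
  "degree_X0 P \<le> n \<Longrightarrow> degree_X0 Q \<le> n \<Longrightarrow> degree_X0 (P - Q) \<le> n"
  by (simp add: degree_X0_le_iff degree_diff_le)

lemma degree_X0_sum_le:
  "(\<And>i. i \<in> A \<Longrightarrow> degree_X0 (f i) \<le> n) \<Longrightarrow> degree_X0 (sum f A) \<le> n"
proof (induction A rule: infinite_finite_induct)
  case (insert x A)
  then show ?case by (simp add: degree_X0_add_le)
qed (simp_all add: degree_X0_le_iff)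

text \<open>Each coefficient of the product is a sum of products of coefficients, and the bound
  holds for every summand.\<close>

lemma degree_X0_mult_le:
  assumes "degree_X0 P \<le> m" and "degree_X0 Q \<le> n"
  shows "degree_X0 (P * Q) \<le> m + n"
proof -
  have "degree (coeff P i * coeff Q j) \<le> m + n" for i j
    using assms by (meson add_mono degree_X0_le_iff degree_mult_le order_trans)
  then show ?thesis
    by (simp add: degree_X0_le_iff coeff_mult degree_sum_le)
qed

lemma degree_X0_const2: "degree_X0 (const2 c) \<le> n"
  unfolding degree_X0_le_iff const2_def by (auto simp: coeff_pCons split: nat.split)

lemma const2_of_nat: "const2 (of_nat n) = of_nat n"
  by (simp add: const2_def of_nat_poly)

lemma degree_X0_of_nat: "degree_X0 (of_nat i) \<le> n"
  unfolding const2_of_nat[symmetric] by (rule degree_X0_const2)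

lemma degree_X0_1: "degree_X0 1 \<le> n"
  using degree_X0_of_nat[of 1] by (simp only: of_nat_1)

lemma degree_X0_X0: "degree_X0 X0 \<le> 1"
  unfolding degree_X0_le_iff X0_def by (auto simp: coeff_pCons split: nat.split)

lemma degree_X0_X1: "degree_X0 X1 \<le> n"
  unfolding degree_X0_le_iff X1_def by (auto simp: coeff_pCons split: nat.split)

lemma degree_X0_prod_le:
  "(\<And>i. i \<in> A \<Longrightarrow> degree_X0 (f i) \<le> k) \<Longrightarrow> degree_X0 (prod f A) \<le> card A * k"
proof (induction A rule: infinite_finite_induct)
  case (insert x A)
  then show ?case by (simp add: degree_X0_mult_le)
qed (simp_all add: degree_X0_1[of 0, simplified])

lemma degree_X0_power_le: "degree_X0 P \<le> k \<Longrightarrow> degree_X0 (P ^ n) \<le> n * k"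
  using degree_X0_prod_le[of "{..<n}" "\<lambda>_. P" k] by simp

section \<open>Evaluation as a ring homomorphism\<close>

lemma eval2_add: "eval2 (P + Q) a b = eval2 P a b + eval2 Q a b"
  by (simp add: eval2_def)

lemma eval2_diff: "eval2 (P - Q) a b = eval2 P a b - eval2 Q a b"
  by (simp add: eval2_def)

lemma eval2_mult: "eval2 (P * Q) a b = eval2 P a b * eval2 Q a b"
  by (simp add: eval2_def)

lemma eval2_power: "eval2 (P ^ n) a b = eval2 P a b ^ n"
  by (simp add: eval2_def)

lemma eval2_sum: "eval2 (sum f A) a b = (\<Sum>i\<in>A. eval2 (f i) a b)"
  by (simp add: eval2_def poly_sum)

lemma eval2_prod: "eval2 (prod f A) a b = (\<Prod>i\<in>A. eval2 (f i) a b)"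
  by (simp add: eval2_def poly_prod)

lemma eval2_const2: "eval2 (const2 c) a b = c"
  by (simp add: eval2_def const2_def)

lemma eval2_of_nat: "eval2 (of_nat n) a b = of_nat n"
  by (simp add: eval2_const2 flip: const2_of_nat)

lemma eval2_1: "eval2 1 a b = 1"
  by (simp add: eval2_def)

lemma eval2_X0: "eval2 X0 a b = a"
  by (simp add: eval2_def X0_def)

lemma eval2_X1: "eval2 X1 a b = b"
  by (simp add: eval2_def X1_def)

lemmas eval2_simps = eval2_add eval2_diff eval2_mult eval2_power eval2_sum eval2_prod
  eval2_const2 eval2_of_nat eval2_1 eval2_X0 eval2_X1

section \<open>Degree in the outer variable \<open>X1\<close>\<close>

lemma degree_mult_le_add: "degree P \<le> m \<Longrightarrow> degree Q \<le> n \<Longrightarrow> degree (P * Q) \<le> m + n"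
  by (meson add_mono degree_mult_le order_trans)

lemma degree_power_le_mult: "degree P \<le> k \<Longrightarrow> degree (P ^ n) \<le> n * k"
  by (metis degree_power_le mult.commute mult_le_mono1 order_trans)

lemma degree_prod_le_mult:
  assumes "finite A" and "\<And>i. i \<in> A \<Longrightarrow> degree (f i) \<le> k"
  shows "degree (prod f A) \<le> card A * k"
  using degree_prod_sum_le[OF assms(1), of f] sum_bounded_above[of A "degree \<circ> f" k] assms(2)
  by simp

lemma degree_const2: "degree (const2 c) = 0"
  by (simp add: const2_def)

lemma degree_of_X0: "degree X0 = 0"
  by (simp add: X0_def)

lemma degree_of_X1: "degree X1 = 1"
  by (simp add: X1_def)

theorem theorem5p5:
  fixes p :: nat
  assumes "prime p" and "p \<ge> 3" and "CARD('p::prime_card) = p"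
  shows "minimal_polynomial_expression
    ((X1 - X0) *
       (\<Sum>d = 2..p - 2. const2 (inverse (of_nat d)) *
          (\<Prod>i = 1..d. X0 + of_nat i) * (\<Prod>i = 0..<p - d. X1 - of_nat i))
     + X0 + (X0 + 1)\<^sup>2 * (1 - (X1 + 1) ^ (p - 1)) + (1 - X0 ^ (p - 1)) * X1\<^sup>2)
    (max_mod_ring :: 'p mod_ring \<Rightarrow> 'p mod_ring \<Rightarrow> 'p mod_ring)"
proof -
  let ?t = "\<lambda>d. const2 (inverse (of_nat d)) * rising X0 d * falling X1 (p - d)
    :: 'p mod_ring poly poly"
  let ?A = "(X1 - X0) * (\<Sum>d = 2..p - 2. ?t d)"
  let ?B = "(X0 + 1)\<^sup>2 * (1 - (X1 + 1) ^ (p - 1)) :: 'p mod_ring poly poly"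
  let ?C = "(1 - X0 ^ (p - 1)) * X1\<^sup>2 :: 'p mod_ring poly poly"
  \<comment> \<open>The factor \<open>X1 - X0\<close> adds one to the degree in either variable, so
    every summand has to stay within \<open>p - 2\<close> in both.\<close>
  have A0: "degree_X0 ?A \<le> 1 + (p - 2)"
  proof (intro degree_X0_mult_le[of "X1 - X0"] degree_X0_sum_le)
    fix d assume d: "d \<in> {2..p - 2}"
    \<comment> \<open>The bound is left unevaluated, in the shape in which the degree rules assemble
      it; likewise for the bounds below.\<close>
    have "degree_X0 (?t d) \<le> (0 + card {1..d} * 1) + card {0..<p - d} * 0"
      by (intro degree_X0_mult_le degree_X0_prod_le degree_X0_add_le degree_X0_diff_le
          degree_X0_const2 degree_X0_X0 degree_X0_X1 degree_X0_1 degree_X0_of_nat)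
    also have "\<dots> \<le> p - 2" using d by simp
    finally show "degree_X0 (?t d) \<le> p - 2" .
  qed (intro degree_X0_diff_le degree_X0_X0 degree_X0_X1 degree_X0_1 degree_X0_of_nat)
  have B0: "degree_X0 ?B \<le> 2 * 1 + (p - 1) * 0"
    by (intro degree_X0_mult_le degree_X0_power_le degree_X0_add_le degree_X0_diff_le
        degree_X0_X0 degree_X0_X1 degree_X0_1 degree_X0_of_nat)
  have C0: "degree_X0 ?C \<le> (p - 1) * 1 + 2 * 0"
    by (intro degree_X0_mult_le degree_X0_power_le degree_X0_diff_le
        degree_X0_X0 degree_X0_X1 degree_X0_1 degree_X0_of_nat)
  have A1: "degree ?A \<le> 1 + (p - 2)"
  proof (intro degree_mult_le_add[of "X1 - X0"] degree_sum_le)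
    fix d assume d: "d \<in> {2..p - 2}"
    have "degree (?t d) \<le> (0 + card {1..d} * 0) + card {0..<p - d} * 1"
      by (intro degree_mult_le_add degree_prod_le_mult degree_add_le degree_diff_le)
        (simp_all add: degree_const2 degree_of_X0 degree_of_X1)
    \<comment> \<open>The lower end \<open>d = 2\<close> of the range matters here, as the upper end
      did for \<open>X0\<close>.\<close>
    also have "\<dots> \<le> p - 2" using d by auto
    finally show "degree (?t d) \<le> p - 2" .
  qed (auto intro: degree_diff_le simp: degree_of_X0 degree_of_X1)
  have B1: "degree ?B \<le> 2 * 0 + (p - 1) * 1"
    by (intro degree_mult_le_add degree_power_le_mult degree_add_le degree_diff_le)
      (simp_all add: degree_of_X0 degree_of_X1)
  have C1: "degree ?C \<le> (p - 1) * 0 + 2 * 1"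
    by (intro degree_mult_le_add degree_power_le_mult degree_diff_le)
      (simp_all add: degree_of_X0 degree_of_X1)
  \<comment> \<open>The squares in the correction terms have degree 2, which is at most
    \<open>p - 1\<close> because \<open>p\<close> is at least 3.\<close>
  have le: "1 + (p - 2) \<le> p - 1" "1 \<le> p - 1" "2 * 1 + (p - 1) * 0 \<le> p - 1"
    "(p - 1) * 1 + 2 * 0 \<le> p - 1" "2 * 0 + (p - 1) * 1 \<le> p - 1"
    "(p - 1) * 0 + 2 * 1 \<le> p - 1"
    using assms(2) by simp_all
  have D0: "degree_X0 (?A + X0 + ?B + ?C) \<le> p - 1"
    by (rule degree_X0_add_le[OF degree_X0_add_le[OF degree_X0_add_le]])
      (rule order_trans[OF A0 le(1)] order_trans[OF degree_X0_X0 le(2)] order_trans[OF B0 le(3)]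
        order_trans[OF C0 le(4)])+
  have D1: "degree (?A + X0 + ?B + ?C) \<le> p - 1"
    by (rule degree_add_le[OF degree_add_le[OF degree_add_le]])
      (rule order_trans[OF A1 le(1)] order_trans[OF eq_refl[OF degree_of_X0] le0]
        order_trans[OF B1 le(5)] order_trans[OF C1 le(6)])+
  have ev: "eval2 (?A + X0 + ?B + ?C) a b = max_mod_ring a b" for a b
    unfolding eval2_simps using max_mod_ring_eq[of a b, unfolded assms(3), OF assms(2)]
    by (simp only:)
  show ?thesis
    unfolding minimal_polynomial_expression_def degree_X1_def assms(3)
    by (rule conjI[OF D0 conjI[OF D1 allI[OF allI[OF ev]]]])
qed

end
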